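(* Let $(\mathcal X,\mathcal A)$ be a measurable space, let $\mathcal P=\{P_\theta:\theta\in\Theta\}\subseteq\mathrm{Prob}(\mathcal X,\mathcal A)$ be a model with $\Theta=\Theta_1\times\Theta_2$, and let $\mathcal C_1,\mathcal C_2$ be sub-$\sigma$-algebras of $\mathcal A$ with these properties: (i) For each $\theta_2\in\Theta_2$, $\mathcal C_1$ is complete for $\{P_{\theta_1,\theta_2}:\theta_1\in\Theta_1\}$. (ii) For each $\theta_1\in\Theta_1$, $\mathcal C_1$ is ancillary and $\mathcal C_2$ is complete and sufficient for $\{P_{\theta_1,\theta_2}:\theta_2\in\Theta_2\}$. (iii) For each $\theta_2\in\Theta_2$, $\{P_{\theta_1,\theta_2}|_{\mathcal C_2}:\theta_1\in\Theta_1\}$ is homogeneous. (iv) $\mathcal L^1(\{P_\theta|_{\mathcal C_1}\otimes P_\theta|_{\mathcal C_2}:\theta\in\Theta\})=\mathcal L^1(\{P_\theta|_{\mathcal C_1}\otimes P_{\theta'}|_{\mathcal C_2}:\theta,\theta'\in\Theta\})$. Then $\mathcal C_1\vee\mathcal C_2$ is complete for $\mathcal P$.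
   Context: $\mathrm{Prob}(\mathcal X,\mathcal A)$ denotes the set of all probability measures (laws) on $(\mathcal X,\mathcal A)$. A model on $(\mathcal X,\mathcal A)$ is a subset of $\mathrm{Prob}(\mathcal X,\mathcal A)$. For a law $P$ and a function $h$, $Ph$ denotes $\int h\,dP$. A sub-$\sigma$-algebra $\mathcal C\subseteq\mathcal A$ is complete for a model $\mathcal P$ if every $\mathcal C$-measurable $h:\mathcal X\to\mathbb R$ that is integrable with respect to every $P\in\mathcal P$ and satisfies $Ph=0$ for all $P\in\mathcal P$ also satisfies $h=0$ $P$-a.s. for every $P\in\mathcal P$. A sub-$\sigma$-algebra $\mathcal C$ is sufficient for $\mathcal P$ if for every $A\in\mathcal A$ there is a $\mathcal C$-measurable function that is a version of the conditional probability $P(A\,|\,\mathcal C)$ simultaneously for all $P\in\mathcal P$. A sub-$\sigma$-algebra $\mathcal C$ is ancillary for a model if the restriction $P|_{\mathcal C}$ is the same for all $P$ in the model. A model is homogeneous if its members are mutually absolutely continuous. $P|_{\mathcal C}$ is the restriction of $P$ to the $\sigma$-algebra $\mathcal C$. The product laws $P_\theta|_{\mathcal C_1}\otimes P_{\theta'}|_{\mathcal C_2}$ are laws on $(\mathcal X\times\mathcal X,\mathcal C_1\otimes\mathcal C_2)$. For a model $\mathcal M$ on a measurable space, $\mathcal L^1(\mathcal M):=\bigcap_{P\in\mathcal M}\mathcal L^1(P)$ is the set of all real-valued measurable functions on that space integrable with respect to every $P\in\mathcal M$. $\mathcal C_1\vee\mathcal C_2$ denotes the $\sigma$-algebra generated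 by $\mathcal C_1\cup\mathcal C_2$. *)

theory Defs
  imports "HOL-Probability.Probability"
begin

text \<open>
  A measurable space is represented by a measure \<open>M\<close> of which only \<open>space M\<close> and \<open>sets M\<close>
  matter; the laws on it are the elements of \<open>space (prob_algebra M)\<close>, and a model is a set of
  such laws.  A sub-\<open>\<sigma>\<close>-algebra is a measure \<open>C\<close> with \<open>subalgebra M C\<close>, again used only through
  its space and its measurable sets.  The restriction of a law \<open>P\<close> to \<open>C\<close> is
  \<open>restr_to_subalg P C\<close>.
\<close>

definition complete_for :: "'a measure \<Rightarrow> 'a measure set \<Rightarrow> bool" where
  "complete_for C \<P> \<longleftrightarrow>
    (\<forall>h \<in> borel_measurable C.
       (\<forall>P\<in>\<P>. integrable P h \<and> (\<integral>x. h x \<partial>P) = (0::real)) \<longrightarrow> (\<forall>P\<in>\<P>. AE x in P. h x = 0))"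

text \<open>
  \<open>real_cond_exp P C (indicat_real A)\<close> is one version of the conditional probability of \<open>A\<close>
  given \<open>C\<close> under \<open>P\<close>; the \<open>C\<close>-measurable functions almost surely equal to it are all the versions.
\<close>

definition sufficient_for :: "'a measure \<Rightarrow> 'a measure \<Rightarrow> 'a measure set \<Rightarrow> bool" where
  "sufficient_for M C \<P> \<longleftrightarrow>
    (\<forall>A \<in> sets M. \<exists>f \<in> borel_measurable C.
       \<forall>P\<in>\<P>. AE x in P. f x = real_cond_exp P C (indicat_real A) x)"

definition ancillary_for :: "'a measure \<Rightarrow> 'a measure set \<Rightarrow> bool" where
  "ancillary_for C \<P> \<longleftrightarrow> (\<forall>P\<in>\<P>. \<forall>Q\<in>\<P>. restr_to_subalg P C = restr_to_subalg Q C)"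

definition homogeneous :: "'a measure set \<Rightarrow> bool" where
  "homogeneous \<P> \<longleftrightarrow> (\<forall>P\<in>\<P>. \<forall>Q\<in>\<P>. absolutely_continuous P Q)"

definition L1_model :: "'a measure \<Rightarrow> 'a measure set \<Rightarrow> ('a \<Rightarrow> real) set" where
  "L1_model M \<P> = {h \<in> borel_measurable M. \<forall>P\<in>\<P>. integrable P h}"

definition sigma_join :: "'a measure \<Rightarrow> 'a measure \<Rightarrow> 'a measure \<Rightarrow> 'a measure" where
  "sigma_join M C\<^sub>1 C\<^sub>2 = sigma (space M) (sets C\<^sub>1 \<union> sets C\<^sub>2)"

end

theory Submission
  imports Defs
begin

text \<open>
  For fixed \<open>\<theta>\<^sub>1\<close>, Basu's theorem makes the ancillary \<open>C\<^sub>1\<close> independent of the complete sufficient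
  \<open>C\<^sub>2\<close> under every \<open>P (\<theta>\<^sub>1, \<theta>\<^sub>2)\<close> (lemma \<open>basu\<close>).  A function \<open>h\<close> measurable with respect to the join
  of \<open>C\<^sub>1\<close> and \<open>C\<^sub>2\<close> has the form \<open>h x = H (x, x)\<close> with \<open>H\<close> measurable on \<open>C\<^sub>1 \<Otimes>\<^sub>M C\<^sub>2\<close>
  (lemma \<open>sigma_join_measurable_factor\<close>), and by independence the diagonal map carries \<open>P \<theta>\<close> to the
  product of its restrictions to \<open>C\<^sub>1\<close> and \<open>C\<^sub>2\<close> (lemma \<open>distr_diagonal_eq_product\<close>).  Thus the claim
  is about a function \<open>H\<close> of two variables with vanishing integral under all these products, and it
  is settled by using the completeness of the two factors one after the other.

  Fix \<open>\<theta>\<^sub>1\<close>.  By ancillarity the first factor \<open>N\<close> of the product does not depend on \<open>\<theta>\<^sub>2\<close>, so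
  \<open>y \<mapsto> \<integral>x. H (x, y) \<partial>N\<close> is one \<open>C\<^sub>2\<close>-measurable function with mean zero under all \<open>P (\<theta>\<^sub>1, \<theta>\<^sub>2)\<close>;
  completeness of \<open>C\<^sub>2\<close> makes it vanish almost surely (lemma \<open>section_integral_vanishes\<close>).  The
  exceptional null set is with respect to \<open>P (\<theta>\<^sub>1, \<theta>\<^sub>2)\<close> with the same \<open>\<theta>\<^sub>1\<close>; homogeneity removes this
  coupling, so that the section integrals for every \<open>\<theta>\<^sub>1\<close> vanish almost surely under a single
  law \<open>P (s\<^sub>0, t\<^sub>0)\<close>.  Now integrate over \<open>y \<in> B\<close> under that law, for \<open>B\<close> in \<open>C\<^sub>2\<close>.  The result is
  a \<open>C\<^sub>1\<close>-measurable function of \<open>x\<close>, and by Fubini it has mean zero under \<open>P (\<theta>\<^sub>1, t\<^sub>0)\<close> for every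
  \<open>\<theta>\<^sub>1\<close>.  Completeness of \<open>C\<^sub>1\<close> makes it vanish, whence \<open>H\<close> integrates to zero over all
  rectangles and is zero almost everywhere (lemma \<open>product_vanishes_if_sections_vanish\<close>).  Fubini
  is applied here to products of restrictions of two different laws, and integrability of \<open>H\<close> under
  those is what the hypothesis on \<open>\<L>\<^sup>1\<close> provides.
\<close>

section \<open>Functions measurable with respect to a join\<close>

text \<open>
  The Doob-Dynkin factorization for real functions.  Every set of the pulled-back \<open>\<sigma>\<close>-algebra is a
  preimage, which gives indicators, and the class of functions that factor is closed under the
  operations that build nonnegative measurable functions.
\<close>

lemma factor_through_vimage_algebra:
  fixes h :: "'a \<Rightarrow> real"
  assumes f: "f \<in> X \<rightarrow> space N"
    and h: "h \<in> borel_measurable (vimage_algebra X f N)"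
  shows "\<exists>g \<in> borel_measurable N. \<forall>x\<in>X. h x = g (f x)"
proof -
  let ?V = "vimage_algebra X f N"
  have nonneg: "\<exists>g \<in> borel_measurable N. \<forall>x\<in>X. u x = g (f x)"
    if "u \<in> borel_measurable ?V" "\<And>x. 0 \<le> u x" for u :: "'a \<Rightarrow> real"
    using that
  proof (induction rule: borel_measurable_induct_real)
    case (set A)
    then obtain B where "B \<in> sets N" "A = f -` B \<inter> X"
      by (auto simp: sets_vimage_algebra2[OF f])
    then show ?case
      by (intro bexI[of _ "indicator B"]) (auto simp: indicator_def)
  next
    case (mult u c)
    then obtain g where "g \<in> borel_measurable N" "\<forall>x\<in>X. u x = g (f x)"
      by blast
    then show ?case
      by (intro bexI[of _ "\<lambda>y. c * g y"]) auto
  next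
    case (add u v)
    then obtain g k where "g \<in> borel_measurable N" "\<forall>x\<in>X. u x = g (f x)"
        "k \<in> borel_measurable N" "\<forall>x\<in>X. v x = k (f x)"
      by blast
    then show ?case
      by (intro bexI[of _ "\<lambda>y. k y + g y"]) auto
  next
    case (seq U)
    then obtain G where G: "\<And>i. G i \<in> borel_measurable N" "\<And>i x. x \<in> X \<Longrightarrow> U i x = G i (f x)"
      by metis
    \<comment> \<open>The \<open>G i\<close> may diverge off the image of \<open>f\<close>; \<open>lim\<close> is measurable in any case.\<close>
    have "u x = lim (\<lambda>i. G i (f x))" if "x \<in> X" for x
      using \<open>\<And>x. x \<in> space ?V \<Longrightarrow> (\<lambda>i. U i x) \<longlonglongrightarrow> u x\<close>[of x] that by (simp add: G(2) limI)
    then show ?case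
      using G(1) by (intro bexI[of _ "\<lambda>y. lim (\<lambda>i. G i y)"]) auto
  qed
  have "(\<lambda>x. max (h x) 0) \<in> borel_measurable ?V" "(\<lambda>x. max (- h x) 0) \<in> borel_measurable ?V"
    using h by measurable
  then have "\<exists>g \<in> borel_measurable N. \<forall>x\<in>X. max (h x) 0 = g (f x)"
    "\<exists>k \<in> borel_measurable N. \<forall>x\<in>X. max (- h x) 0 = k (f x)"
    by (intro nonneg; simp)+
  then obtain g k where
      g: "g \<in> borel_measurable N" "\<And>x. x \<in> X \<Longrightarrow> max (h x) 0 = g (f x)" and
      k: "k \<in> borel_measurable N" "\<And>x. x \<in> X \<Longrightarrow> max (- h x) 0 = k (f x)"
    by blast
  show ?thesis
  proof (intro bexI ballI)
    show "(\<lambda>y. g y - k y) \<in> borel_measurable N"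
      using g(1) k(1) by measurable
    show "h x = g (f x) - k (f x)" if "x \<in> X" for x
      using g(2)[OF that] k(2)[OF that] by linarith
  qed
qed

text \<open>
  The pull-back of \<open>C\<^sub>1 \<Otimes>\<^sub>M C\<^sub>2\<close> along the diagonal contains \<open>C\<^sub>1\<close> and \<open>C\<^sub>2\<close>, because a set \<open>A\<close> is the
  trace of the cylinder over \<open>A\<close> in either direction; hence it contains their join.
\<close>

lemma sigma_join_measurable_factor:
  fixes h :: "'a \<Rightarrow> real"
  assumes "subalgebra M C\<^sub>1" "subalgebra M C\<^sub>2"
    and h: "h \<in> borel_measurable (sigma_join M C\<^sub>1 C\<^sub>2)"
  shows "\<exists>H \<in> borel_measurable (C\<^sub>1 \<Otimes>\<^sub>M C\<^sub>2). \<forall>x\<in>space M. h x = H (x, x)"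
proof -
  let ?d = "\<lambda>x. (x, x)" and ?X = "space M"
  let ?V = "vimage_algebra ?X ?d (C\<^sub>1 \<Otimes>\<^sub>M C\<^sub>2)"
  have sp: "space C\<^sub>1 = ?X" "space C\<^sub>2 = ?X"
    using assms by (auto simp: subalgebra_def)
  have sub: "sets C\<^sub>1 \<union> sets C\<^sub>2 \<subseteq> Pow ?X"
    using sets.space_closed[of C\<^sub>1] sets.space_closed[of C\<^sub>2] sp by auto
  have "A \<in> sets ?V" if "A \<in> sets C\<^sub>1 \<union> sets C\<^sub>2" for A
  proof (cases "A \<in> sets C\<^sub>1")
    case True
    then have "?d -` (A \<times> space C\<^sub>2) \<inter> ?X \<in> sets ?V"
      by (intro in_vimage_algebra pair_measureI) auto
    moreover have "?d -` (A \<times> space C\<^sub>2) \<inter> ?X = A"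
      using sub that sp by blast
    ultimately show ?thesis by simp
  next
    case False
    then have "?d -` (space C\<^sub>1 \<times> A) \<inter> ?X \<in> sets ?V"
      using that by (intro in_vimage_algebra pair_measureI) auto
    moreover have "?d -` (space C\<^sub>1 \<times> A) \<inter> ?X = A"
      using sub that sp by blast
    ultimately show ?thesis by simp
  qed
  then have "sigma_sets (space ?V) (sets C\<^sub>1 \<union> sets C\<^sub>2) \<subseteq> sets ?V"
    by (intro sets.sigma_sets_subset) auto
  then have "sets (sigma_join M C\<^sub>1 C\<^sub>2) \<subseteq> sets ?V"
    using sub by (simp add: sigma_join_def sets_measure_of)
  then have "subalgebra ?V (sigma_join M C\<^sub>1 C\<^sub>2)"
    using sub by (simp add: subalgebra_def sigma_join_def space_measure_of)
  then have "h \<in> borel_measurable ?V"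
    using h by (rule measurable_from_subalg)
  moreover have "?d \<in> ?X \<rightarrow> space (C\<^sub>1 \<Otimes>\<^sub>M C\<^sub>2)"
    by (simp add: space_pair_measure sp)
  ultimately show ?thesis
    using factor_through_vimage_algebra by blast
qed

section \<open>Independence of the two factors\<close>

lemma subalgebra_law:
  assumes "Q \<in> space (prob_algebra M)" "subalgebra M C"
  shows "subalgebra Q C"
proof -
  have "sets Q = sets M"
    using assms(1) by (simp add: space_prob_algebra)
  then show ?thesis
    using assms(2) sets_eq_imp_space_eq[of Q M] by (simp add: subalgebra_def)
qed

lemma prob_space_restriction:
  assumes "Q \<in> space (prob_algebra M)" "subalgebra M C"
  shows "prob_space (restr_to_subalg Q C)"
  using assms prob_space_restr_to_subalg[OF subalgebra_law]
  by (auto simp: space_prob_algebra)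

text \<open>
  A common version \<open>f\<close> of the conditional probability of \<open>A\<close> has mean \<open>Q A\<close> under every law \<open>Q\<close> of
  the model, and by ancillarity this is one constant \<open>c\<close>.  Completeness applied to \<open>f - c\<close> shows that
  conditioning on \<open>C\<^sub>2\<close> does not change the probability of \<open>A\<close>.
\<close>

lemma basu:
  assumes model: "\<P> \<subseteq> space (prob_algebra M)"
    and sub1: "subalgebra M C\<^sub>1" and sub2: "subalgebra M C\<^sub>2"
    and anc: "ancillary_for C\<^sub>1 \<P>"
    and comp: "complete_for C\<^sub>2 \<P>" and suff: "sufficient_for M C\<^sub>2 \<P>"
    and Q: "Q \<in> \<P>" and A: "A \<in> sets C\<^sub>1" and B: "B \<in> sets C\<^sub>2"
  shows "emeasure Q (A \<inter> B) = emeasure Q A * emeasure Q B"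
proof -
  have AM: "A \<in> sets M" and BM: "B \<in> sets M"
    using A B sub1 sub2 by (auto simp: subalgebra_def)
  then obtain f where f: "f \<in> borel_measurable C\<^sub>2"
    and f_eq: "\<And>R. R \<in> \<P> \<Longrightarrow> AE x in R. f x = real_cond_exp R C\<^sub>2 (indicat_real A) x"
    using suff unfolding sufficient_for_def by blast
  have law: "integrable R f \<and> (\<integral>x. f x \<partial>R) = measure R A \<and>
      (\<integral>x. indicator B x * f x \<partial>R) = measure R (A \<inter> B)" if R: "R \<in> \<P>" for R
  proof -
    have Rp: "R \<in> space (prob_algebra M)"
      using R model by blast
    then interpret R: prob_space R
      by (simp add: space_prob_algebra)
    have sR: "sets R = sets M"
      using Rp by (simp add: space_prob_algebra)
    have subR: "subalgebra R C\<^sub>2"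
      using Rp sub2 by (rule subalgebra_law)
    interpret finite_measure_subalgebra R C\<^sub>2
      by unfold_locales (rule subR)
    have [measurable]: "A \<in> sets R" "B \<in> sets R" "f \<in> borel_measurable R"
      "real_cond_exp R C\<^sub>2 (indicat_real A) \<in> borel_measurable R"
      using AM BM sR measurable_from_subalg[OF subR f] by auto
    have intA: "integrable R (indicat_real A)"
      by (simp add: R.emeasure_eq_measure)
    have ae: "AE x in R. f x = real_cond_exp R C\<^sub>2 (indicat_real A) x"
      using f_eq R .
    have 1: "integrable R f"
      using integrable_cong_AE[OF _ _ ae] real_cond_exp_int(1)[OF intA] by simp
    have 2: "(\<integral>x. f x \<partial>R) = measure R A"
      using integral_cong_AE[OF _ _ ae] real_cond_exp_int(2)[OF intA] by simp
    have "(\<integral>x. indicator B x * f x \<partial>R) =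
        (\<integral>x. indicator B x * real_cond_exp R C\<^sub>2 (indicat_real A) x \<partial>R)"
      using ae by (intro integral_cong_AE) auto
    also have "\<dots> = (\<integral>x. indicator B x * indicat_real A x \<partial>R)"
      using real_cond_exp_intA[OF intA B] by (simp add: set_lebesgue_integral_def)
    also have "\<dots> = measure R (A \<inter> B)"
      by (simp add: indicator_inter_arith[symmetric] Int_commute)
    finally show ?thesis
      using 1 2 by simp
  qed
  define c where "c = measure Q A"
  have c: "measure R A = c" if "R \<in> \<P>" for R
  proof -
    have "subalgebra R C\<^sub>1" "subalgebra Q C\<^sub>1"
      using that Q model sub1 by (auto intro: subalgebra_law)
    moreover have "restr_to_subalg R C\<^sub>1 = restr_to_subalg Q C\<^sub>1"
      using anc that Q unfolding ancillary_for_def by blast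
    ultimately have "emeasure R A = emeasure Q A"
      using A by (metis emeasure_restr_to_subalg)
    then show ?thesis
      by (simp add: c_def measure_def)
  qed
  have "\<forall>R\<in>\<P>. integrable R (\<lambda>x. f x - c) \<and> (\<integral>x. f x - c \<partial>R) = 0"
  proof
    fix R assume R: "R \<in> \<P>"
    then interpret prob_space R
      using model by (auto simp: space_prob_algebra)
    show "integrable R (\<lambda>x. f x - c) \<and> (\<integral>x. f x - c \<partial>R) = 0"
      using law[OF R] c[OF R] by (simp add: prob_space)
  qed
  moreover have "(\<lambda>x. f x - c) \<in> borel_measurable C\<^sub>2"
    using f by measurable
  ultimately have ae: "AE x in Q. f x - c = 0"
    using comp Q unfolding complete_for_def by blast
  have Qp: "Q \<in> space (prob_algebra M)"
    using Q model by blast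
  then interpret Q: prob_space Q
    by (simp add: space_prob_algebra)
  have [measurable]: "B \<in> sets Q"
    using Qp BM by (simp add: space_prob_algebra)
  have [measurable]: "f \<in> borel_measurable Q"
    using measurable_from_subalg[OF subalgebra_law[OF Qp sub2] f] .
  have "measure Q (A \<inter> B) = (\<integral>x. indicator B x * f x \<partial>Q)"
    using law[OF Q] by simp
  also have "\<dots> = (\<integral>x. indicator B x * c \<partial>Q)"
    using ae by (intro integral_cong_AE) auto
  also have "\<dots> = measure Q A * measure Q B"
    by (simp add: c_def)
  finally show ?thesis
    by (simp add: Q.emeasure_eq_measure ennreal_mult'')
qed

text \<open>
  Independence in the form needed for integrals: the preimage of \<open>A \<times> B\<close> under the diagonal map
  is \<open>A \<inter> B\<close>, so the image law agrees with the product on rectangles.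
\<close>

lemma distr_diagonal_eq_product:
  assumes Q: "Q \<in> space (prob_algebra M)"
    and sub1: "subalgebra M C\<^sub>1" and sub2: "subalgebra M C\<^sub>2"
    and indep: "\<And>A B. A \<in> sets C\<^sub>1 \<Longrightarrow> B \<in> sets C\<^sub>2 \<Longrightarrow>
      emeasure Q (A \<inter> B) = emeasure Q A * emeasure Q B"
  shows "(\<lambda>x. (x, x)) \<in> measurable Q (C\<^sub>1 \<Otimes>\<^sub>M C\<^sub>2)"
    and "distr Q (C\<^sub>1 \<Otimes>\<^sub>M C\<^sub>2) (\<lambda>x. (x, x)) = restr_to_subalg Q C\<^sub>1 \<Otimes>\<^sub>M restr_to_subalg Q C\<^sub>2"
proof -
  note subQ = subalgebra_law[OF Q sub1] subalgebra_law[OF Q sub2]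
  note sets_R = sets_restr_to_subalg[OF subQ(1)] sets_restr_to_subalg[OF subQ(2)]
  interpret R1: prob_space "restr_to_subalg Q C\<^sub>1"
    using Q sub1 by (rule prob_space_restriction)
  interpret R2: prob_space "restr_to_subalg Q C\<^sub>2"
    using Q sub2 by (rule prob_space_restriction)
  show d: "(\<lambda>x. (x, x)) \<in> measurable Q (C\<^sub>1 \<Otimes>\<^sub>M C\<^sub>2)"
    by (intro measurable_Pair measurable_from_subalg[OF subQ(1)]
        measurable_from_subalg[OF subQ(2)]) simp_all
  show "distr Q (C\<^sub>1 \<Otimes>\<^sub>M C\<^sub>2) (\<lambda>x. (x, x)) = restr_to_subalg Q C\<^sub>1 \<Otimes>\<^sub>M restr_to_subalg Q C\<^sub>2"
  proof (rule pair_measure_eqI[symmetric])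
    show "sigma_finite_measure (restr_to_subalg Q C\<^sub>1)" "sigma_finite_measure (restr_to_subalg Q C\<^sub>2)"
      by unfold_locales
    show "sets (restr_to_subalg Q C\<^sub>1 \<Otimes>\<^sub>M restr_to_subalg Q C\<^sub>2) =
        sets (distr Q (C\<^sub>1 \<Otimes>\<^sub>M C\<^sub>2) (\<lambda>x. (x, x)))"
      using sets_pair_measure_cong[OF sets_R] by simp
    fix A B assume "A \<in> sets (restr_to_subalg Q C\<^sub>1)" "B \<in> sets (restr_to_subalg Q C\<^sub>2)"
    then have A: "A \<in> sets C\<^sub>1" and B: "B \<in> sets C\<^sub>2"
      by (simp_all add: sets_R)
    have "A \<subseteq> space Q"
      using sets.sets_into_space[OF A] subQ(1) by (simp add: subalgebra_def)
    then have "(\<lambda>x. (x, x)) -` (A \<times> B) \<inter> space Q = A \<inter> B"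
      by auto
    then show "emeasure (restr_to_subalg Q C\<^sub>1) A * emeasure (restr_to_subalg Q C\<^sub>2) B =
        emeasure (distr Q (C\<^sub>1 \<Otimes>\<^sub>M C\<^sub>2) (\<lambda>x. (x, x))) (A \<times> B)"
      using indep[OF A B] A B d
      by (simp add: emeasure_distr emeasure_restr_to_subalg[OF subQ(1)]
          emeasure_restr_to_subalg[OF subQ(2)])
  qed
qed

section \<open>Functions on the product\<close>

text \<open>
  Rectangles form an intersection-stable generator and the sets over which \<open>H\<close> integrates to zero
  form a Dynkin system, so the integrals of \<open>H\<close> over all measurable sets vanish.
\<close>

lemma AE_zero_if_integrals_zero_on_rectangles:
  fixes H :: "'a \<times> 'b \<Rightarrow> real"
  assumes "prob_space N\<^sub>1" "prob_space N\<^sub>2"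
    and H: "integrable (N\<^sub>1 \<Otimes>\<^sub>M N\<^sub>2) H"
    and rect: "\<And>A B. A \<in> sets N\<^sub>1 \<Longrightarrow> B \<in> sets N\<^sub>2 \<Longrightarrow>
      (\<integral>z. indicator (A \<times> B) z * H z \<partial>(N\<^sub>1 \<Otimes>\<^sub>M N\<^sub>2)) = 0"
  shows "AE z in N\<^sub>1 \<Otimes>\<^sub>M N\<^sub>2. H z = 0"
proof -
  let ?N = "N\<^sub>1 \<Otimes>\<^sub>M N\<^sub>2"
  interpret pair_prob_space N\<^sub>1 N\<^sub>2
    using assms(1,2) by (simp add: pair_prob_space_def pair_sigma_finite_def prob_space_imp_sigma_finite)
  show ?thesis
  proof (rule P.density_zero[OF H])
    have HI: "set_integrable ?N D H" if "D \<in> sets ?N" for D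
      unfolding set_integrable_def using integrable_mult_indicator[OF that H] .
    fix D assume "D \<in> sets ?N"
    with Int_stable_pair_measure_generator pair_measure_closed
    show "(LINT z:D|?N. H z) = 0"
      unfolding sets_pair_measure
    proof (induction rule: sigma_sets_induct_disjoint)
      case (basic D)
      then show ?case
        using rect by (auto simp: set_lebesgue_integral_def)
    next
      case empty
      then show ?case by (simp add: set_lebesgue_integral_def)
    next
      case (compl D)
      then have D: "D \<in> sets ?N"
        unfolding sets_pair_measure by blast
      have "(LINT z:space ?N|?N. H z) = 0"
        using rect[OF sets.top sets.top]
        by (simp add: set_lebesgue_integral_def space_pair_measure)
      moreover have "(LINT z:space ?N|?N. H z) = (LINT z:D \<union> (space ?N - D)|?N. H z)"
        using sets.sets_into_space[OF D] by (simp add: Un_absorb1)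
      moreover have "\<dots> = (LINT z:D|?N. H z) + (LINT z:space ?N - D|?N. H z)"
        using D by (intro set_integral_Un HI) auto
      ultimately show ?case
        using compl by (simp add: space_pair_measure)
    next
      case (union F)
      then have F: "F i \<in> sets ?N" for i
        unfolding sets_pair_measure by blast
      have "(LINT z:(\<Union>i. F i)|?N. H z) = (\<Sum>i. (LINT z:F i|?N. H z))"
        using F union(1)
        by (intro lebesgue_integral_countable_add HI) (auto simp: disjoint_family_on_def)
      then show ?case
        using union by simp
    qed
  qed
qed

text \<open>
  This uses completeness of the second factor.  The law \<open>N\<close> stands for the common restriction of a
  model to an ancillary \<open>\<sigma>\<close>-algebra: that it is the same for all \<open>Q\<close> makes the section integral a
  single function to which completeness applies.
\<close>

lemma section_integral_vanishes:
  fixes H :: "'b \<times> 'a \<Rightarrow> real"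
  assumes model: "\<P> \<subseteq> space (prob_algebra M)"
    and sub2: "subalgebra M C\<^sub>2"
    and comp: "complete_for C\<^sub>2 \<P>"
    and N: "prob_space N"
    and int: "\<And>Q. Q \<in> \<P> \<Longrightarrow> integrable (N \<Otimes>\<^sub>M restr_to_subalg Q C\<^sub>2) H"
    and zero: "\<And>Q. Q \<in> \<P> \<Longrightarrow> (\<integral>z. H z \<partial>(N \<Otimes>\<^sub>M restr_to_subalg Q C\<^sub>2)) = 0"
    and Q: "Q \<in> \<P>"
  shows "AE y in restr_to_subalg Q C\<^sub>2. (\<integral>x. H (x, y) \<partial>N) = 0"
proof -
  define g where "g y = (\<integral>x. H (x, y) \<partial>N)" for y
  have R: "g \<in> borel_measurable C\<^sub>2 \<and> integrable R g \<and> (\<integral>y. g y \<partial>R) = 0" if R: "R \<in> \<P>" for R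
  proof -
    have Rp: "R \<in> space (prob_algebra M)"
      using R model by blast
    note subR = subalgebra_law[OF Rp sub2]
    interpret N: prob_space N by fact
    interpret R2: prob_space "restr_to_subalg R C\<^sub>2"
      using Rp sub2 by (rule prob_space_restriction)
    interpret pair_sigma_finite N "restr_to_subalg R C\<^sub>2" ..
    have int_g: "integrable (restr_to_subalg R C\<^sub>2) g"
      unfolding g_def using int[OF R] by (intro integrable_snd) simp
    then have g: "g \<in> borel_measurable C\<^sub>2"
      by (intro measurable_in_subalg'[OF subR] borel_measurable_integrable)
    have "(\<integral>y. g y \<partial>restr_to_subalg R C\<^sub>2) = 0"
      unfolding g_def using integral_snd[of "\<lambda>x y. H (x, y)"] int[OF R] zero[OF R] by simp
    then show ?thesis
      using g int_g integrable_from_subalg[OF subR] integral_subalgebra2[OF subR g] by simp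
  qed
  then have "AE y in Q. g y = 0"
    using comp Q unfolding complete_for_def by blast
  moreover have "subalgebra Q C\<^sub>2"
    using Q model sub2 by (auto intro: subalgebra_law)
  moreover have [measurable]: "g \<in> borel_measurable C\<^sub>2"
    using R[OF Q] by blast
  have "Measurable.pred C\<^sub>2 (\<lambda>y. g y = 0)"
    by measurable
  ultimately show ?thesis
    unfolding g_def by (intro AE_restr_to_subalg2)
qed

text \<open>
  This uses completeness of the first factor against a fixed law \<open>N\<close> in the second.  Completeness is
  not applied to the sections \<open>x \<mapsto> H (x, y)\<close> themselves: for them the exceptional set of \<open>y\<close> in the
  hypothesis \<open>zero\<close> depends on \<open>Q\<close>, and an uncountable model would leave no common \<open>y\<close>.  Averaging
  over \<open>y \<in> B\<close> gives a function whose mean is exactly zero under every \<open>Q\<close>.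
\<close>

lemma product_vanishes_if_sections_vanish:
  fixes H :: "'a \<times> 'b \<Rightarrow> real"
  assumes model: "\<P> \<subseteq> space (prob_algebra M)"
    and sub1: "subalgebra M C\<^sub>1"
    and comp: "complete_for C\<^sub>1 \<P>"
    and N: "prob_space N"
    and int: "\<And>Q. Q \<in> \<P> \<Longrightarrow> integrable (restr_to_subalg Q C\<^sub>1 \<Otimes>\<^sub>M N) H"
    and zero: "\<And>Q. Q \<in> \<P> \<Longrightarrow> AE y in N. (\<integral>x. H (x, y) \<partial>restr_to_subalg Q C\<^sub>1) = 0"
    and Q: "Q \<in> \<P>"
  shows "AE z in restr_to_subalg Q C\<^sub>1 \<Otimes>\<^sub>M N. H z = 0"
proof (rule AE_zero_if_integrals_zero_on_rectangles)
  show "prob_space (restr_to_subalg Q C\<^sub>1)"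
    using Q model sub1 by (auto intro: prob_space_restriction)
  show "prob_space N"
    by (fact N)
  show "integrable (restr_to_subalg Q C\<^sub>1 \<Otimes>\<^sub>M N) H"
    using int Q .
  fix A B assume A': "A \<in> sets (restr_to_subalg Q C\<^sub>1)" and B: "B \<in> sets N"
  define k where "k x = (\<integral>y. indicator B y * H (x, y) \<partial>N)" for x
  interpret N: prob_space N by fact
  have intB: "integrable (restr_to_subalg R C\<^sub>1 \<Otimes>\<^sub>M N) (\<lambda>(x, y). indicator B y * H (x, y))"
    if R: "R \<in> \<P>" for R
  proof -
    have "integrable (restr_to_subalg R C\<^sub>1 \<Otimes>\<^sub>M N)
        (\<lambda>z. indicator (space (restr_to_subalg R C\<^sub>1) \<times> B) z *\<^sub>R H z)"
      using B by (intro integrable_mult_indicator int R) auto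
    moreover have "integrable (restr_to_subalg R C\<^sub>1 \<Otimes>\<^sub>M N)
        (\<lambda>z. indicator (space (restr_to_subalg R C\<^sub>1) \<times> B) z *\<^sub>R H z) =
        integrable (restr_to_subalg R C\<^sub>1 \<Otimes>\<^sub>M N) (\<lambda>(x, y). indicator B y * H (x, y))"
      by (intro Bochner_Integration.integrable_cong refl)
        (auto simp: space_pair_measure indicator_def)
    ultimately show ?thesis
      by simp
  qed
  have R: "k \<in> borel_measurable C\<^sub>1 \<and> integrable R k \<and> (\<integral>x. k x \<partial>R) = 0" if R: "R \<in> \<P>" for R
  proof -
    have Rp: "R \<in> space (prob_algebra M)"
      using R model by blast
    note subR = subalgebra_law[OF Rp sub1]
    interpret R1: prob_space "restr_to_subalg R C\<^sub>1"
      using Rp sub1 by (rule prob_space_restriction)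
    interpret pair_sigma_finite "restr_to_subalg R C\<^sub>1" N ..
    have int_k: "integrable (restr_to_subalg R C\<^sub>1) k"
      unfolding k_def using integrable_fst'[OF intB[OF R]] by simp
    then have k: "k \<in> borel_measurable C\<^sub>1"
      by (intro measurable_in_subalg'[OF subR] borel_measurable_integrable)
    have "(\<integral>x. k x \<partial>restr_to_subalg R C\<^sub>1) =
        (\<integral>y. (\<integral>x. indicator B y * H (x, y) \<partial>restr_to_subalg R C\<^sub>1) \<partial>N)"
      unfolding k_def using Fubini_integral[OF intB[OF R]] by simp
    also have "\<dots> = (\<integral>y. indicator B y * (\<integral>x. H (x, y) \<partial>restr_to_subalg R C\<^sub>1) \<partial>N)"
      by simp
    also have "\<dots> = 0"
      using zero[OF R] by (intro integral_eq_zero_AE) auto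
    finally show ?thesis
      using k int_k integrable_from_subalg[OF subR] integral_subalgebra2[OF subR k] by simp
  qed
  then have ae: "AE x in Q. k x = 0"
    using comp Q unfolding complete_for_def by blast
  have Qp: "Q \<in> space (prob_algebra M)"
    using Q model by blast
  note subQ = subalgebra_law[OF Qp sub1]
  have [measurable]: "k \<in> borel_measurable C\<^sub>1"
    using R[OF Q] by blast
  have "Measurable.pred C\<^sub>1 (\<lambda>x. k x = 0)"
    by measurable
  with subQ ae have ae: "AE x in restr_to_subalg Q C\<^sub>1. k x = 0"
    by (intro AE_restr_to_subalg2)
  interpret Q1: prob_space "restr_to_subalg Q C\<^sub>1"
    using Qp sub1 by (rule prob_space_restriction)
  interpret pair_sigma_finite "restr_to_subalg Q C\<^sub>1" N ..
  have "integrable (restr_to_subalg Q C\<^sub>1 \<Otimes>\<^sub>M N) (\<lambda>z. indicator (A \<times> B) z * H z)"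
    using integrable_mult_indicator[OF _ int[OF Q], of "A \<times> B"] A' B by simp
  then have "(\<integral>z. indicator (A \<times> B) z * H z \<partial>(restr_to_subalg Q C\<^sub>1 \<Otimes>\<^sub>M N)) =
      (\<integral>x. (\<integral>y. indicator (A \<times> B) (x, y) * H (x, y) \<partial>N) \<partial>restr_to_subalg Q C\<^sub>1)"
    by (rule integral_fst'[symmetric])
  also have "\<dots> = (\<integral>x. indicator A x * k x \<partial>restr_to_subalg Q C\<^sub>1)"
    by (simp add: k_def indicator_times mult.assoc)
  also have "\<dots> = 0"
    using ae by (intro integral_eq_zero_AE) auto
  finally show "(\<integral>z. indicator (A \<times> B) z * H z \<partial>(restr_to_subalg Q C\<^sub>1 \<Otimes>\<^sub>M N)) = 0" .
qed

section \<open>Completeness of the join\<close>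

theorem theorem1p4:
  fixes M C\<^sub>1 C\<^sub>2 :: "'a measure"
    and P :: "'b \<times> 'c \<Rightarrow> 'a measure"
    and \<Theta>\<^sub>1 :: "'b set" and \<Theta>\<^sub>2 :: "'c set"
  assumes model: "\<And>\<theta>. \<theta> \<in> \<Theta>\<^sub>1 \<times> \<Theta>\<^sub>2 \<Longrightarrow> P \<theta> \<in> space (prob_algebra M)"
    and sub1: "subalgebra M C\<^sub>1"
    and sub2: "subalgebra M C\<^sub>2"
    and i: "\<And>\<theta>\<^sub>2. \<theta>\<^sub>2 \<in> \<Theta>\<^sub>2 \<Longrightarrow> complete_for C\<^sub>1 {P (\<theta>\<^sub>1, \<theta>\<^sub>2) | \<theta>\<^sub>1. \<theta>\<^sub>1 \<in> \<Theta>\<^sub>1}"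
    and ii: "\<And>\<theta>\<^sub>1. \<theta>\<^sub>1 \<in> \<Theta>\<^sub>1 \<Longrightarrow>
        ancillary_for C\<^sub>1 {P (\<theta>\<^sub>1, \<theta>\<^sub>2) | \<theta>\<^sub>2. \<theta>\<^sub>2 \<in> \<Theta>\<^sub>2} \<and>
        complete_for C\<^sub>2 {P (\<theta>\<^sub>1, \<theta>\<^sub>2) | \<theta>\<^sub>2. \<theta>\<^sub>2 \<in> \<Theta>\<^sub>2} \<and>
        sufficient_for M C\<^sub>2 {P (\<theta>\<^sub>1, \<theta>\<^sub>2) | \<theta>\<^sub>2. \<theta>\<^sub>2 \<in> \<Theta>\<^sub>2}"
    and iii: "\<And>\<theta>\<^sub>2. \<theta>\<^sub>2 \<in> \<Theta>\<^sub>2 \<Longrightarrow>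
        homogeneous {restr_to_subalg (P (\<theta>\<^sub>1, \<theta>\<^sub>2)) C\<^sub>2 | \<theta>\<^sub>1. \<theta>\<^sub>1 \<in> \<Theta>\<^sub>1}"
    and iv: "L1_model (C\<^sub>1 \<Otimes>\<^sub>M C\<^sub>2)
          {restr_to_subalg (P \<theta>) C\<^sub>1 \<Otimes>\<^sub>M restr_to_subalg (P \<theta>) C\<^sub>2 | \<theta>. \<theta> \<in> \<Theta>\<^sub>1 \<times> \<Theta>\<^sub>2} =
        L1_model (C\<^sub>1 \<Otimes>\<^sub>M C\<^sub>2)
          {restr_to_subalg (P \<theta>) C\<^sub>1 \<Otimes>\<^sub>M restr_to_subalg (P \<theta>') C\<^sub>2 | \<theta> \<theta>'.
             \<theta> \<in> \<Theta>\<^sub>1 \<times> \<Theta>\<^sub>2 \<and> \<theta>' \<in> \<Theta>\<^sub>1 \<times> \<Theta>\<^sub>2}"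
  shows "complete_for (sigma_join M C\<^sub>1 C\<^sub>2) {P \<theta> | \<theta>. \<theta> \<in> \<Theta>\<^sub>1 \<times> \<Theta>\<^sub>2}"
proof -
  define R1 where "R1 \<theta> = restr_to_subalg (P \<theta>) C\<^sub>1" for \<theta>
  define R2 where "R2 \<theta> = restr_to_subalg (P \<theta>) C\<^sub>2" for \<theta>
  have sub: "subalgebra (P \<theta>) C\<^sub>1" "subalgebra (P \<theta>) C\<^sub>2" if "\<theta> \<in> \<Theta>\<^sub>1 \<times> \<Theta>\<^sub>2" for \<theta>
    using that model sub1 sub2 by (auto intro: subalgebra_law)
  have prob: "prob_space (R1 \<theta>)" "prob_space (R2 \<theta>)" if "\<theta> \<in> \<Theta>\<^sub>1 \<times> \<Theta>\<^sub>2" for \<theta>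
    using that model sub1 sub2 unfolding R1_def R2_def by (auto intro: prob_space_restriction)
  have slice1: "{P (s, t) | s. s \<in> \<Theta>\<^sub>1} \<subseteq> space (prob_algebra M)" if "t \<in> \<Theta>\<^sub>2" for t
    using that model by auto
  have slice2: "{P (s, t) | t. t \<in> \<Theta>\<^sub>2} \<subseteq> space (prob_algebra M)" if "s \<in> \<Theta>\<^sub>1" for s
    using that model by auto
  have diag: "(\<lambda>x. (x, x)) \<in> measurable (P \<theta>) (C\<^sub>1 \<Otimes>\<^sub>M C\<^sub>2)"
      "distr (P \<theta>) (C\<^sub>1 \<Otimes>\<^sub>M C\<^sub>2) (\<lambda>x. (x, x)) = R1 \<theta> \<Otimes>\<^sub>M R2 \<theta>"
    if \<theta>: "\<theta> \<in> \<Theta>\<^sub>1 \<times> \<Theta>\<^sub>2" for \<theta>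
  proof -
    obtain s t where st: "\<theta> = (s, t)" "s \<in> \<Theta>\<^sub>1" "t \<in> \<Theta>\<^sub>2"
      using \<theta> by auto
    have "emeasure (P \<theta>) (A \<inter> B) = emeasure (P \<theta>) A * emeasure (P \<theta>) B"
      if "A \<in> sets C\<^sub>1" "B \<in> sets C\<^sub>2" for A B
      using basu[OF slice2 sub1 sub2] ii[OF st(2)] st that by blast
    then show "(\<lambda>x. (x, x)) \<in> measurable (P \<theta>) (C\<^sub>1 \<Otimes>\<^sub>M C\<^sub>2)"
      "distr (P \<theta>) (C\<^sub>1 \<Otimes>\<^sub>M C\<^sub>2) (\<lambda>x. (x, x)) = R1 \<theta> \<Otimes>\<^sub>M R2 \<theta>"
      unfolding R1_def R2_def using distr_diagonal_eq_product[OF model[OF \<theta>] sub1 sub2] by blast+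
  qed
  show ?thesis
    unfolding complete_for_def
  proof (intro ballI impI)
    fix h Q
    assume h: "h \<in> borel_measurable (sigma_join M C\<^sub>1 C\<^sub>2)"
      and h0: "\<forall>Q\<in>{P \<theta> | \<theta>. \<theta> \<in> \<Theta>\<^sub>1 \<times> \<Theta>\<^sub>2}. integrable Q h \<and> (\<integral>x. h x \<partial>Q) = (0::real)"
      and "Q \<in> {P \<theta> | \<theta>. \<theta> \<in> \<Theta>\<^sub>1 \<times> \<Theta>\<^sub>2}"
    then obtain s\<^sub>0 t\<^sub>0 where st: "Q = P (s\<^sub>0, t\<^sub>0)" "s\<^sub>0 \<in> \<Theta>\<^sub>1" "t\<^sub>0 \<in> \<Theta>\<^sub>2"
      by auto
    obtain H where H: "H \<in> borel_measurable (C\<^sub>1 \<Otimes>\<^sub>M C\<^sub>2)"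
      and hH: "\<And>x. x \<in> space M \<Longrightarrow> h x = H (x, x)"
      using sigma_join_measurable_factor[OF sub1 sub2 h] by blast
    have hH': "h x = H (x, x)" if "x \<in> space (P \<theta>)" "\<theta> \<in> \<Theta>\<^sub>1 \<times> \<Theta>\<^sub>2" for x \<theta>
      using that sub[of \<theta>] sub1 hH by (simp add: subalgebra_def)
    have own: "integrable (R1 \<theta> \<Otimes>\<^sub>M R2 \<theta>) H \<and> (\<integral>z. H z \<partial>(R1 \<theta> \<Otimes>\<^sub>M R2 \<theta>)) = 0"
      if \<theta>: "\<theta> \<in> \<Theta>\<^sub>1 \<times> \<Theta>\<^sub>2" for \<theta>
    proof -
      have "integrable (P \<theta>) h" "(\<integral>x. h x \<partial>P \<theta>) = 0"
        using h0 \<theta> by auto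
      moreover have "integrable (P \<theta>) h = integrable (P \<theta>) (\<lambda>x. H (x, x))"
        "(\<integral>x. h x \<partial>P \<theta>) = (\<integral>x. H (x, x) \<partial>P \<theta>)"
        using hH'[OF _ \<theta>] by (auto intro!: Bochner_Integration.integrable_cong Bochner_Integration.integral_cong)
      ultimately show ?thesis
        unfolding diag(2)[OF \<theta>, symmetric]
        using integrable_distr_eq[OF diag(1)[OF \<theta>] H] integral_distr[OF diag(1)[OF \<theta>] H] by simp
    qed
    \<comment> \<open>Independence only gives integrability under products of restrictions of one and the same law;
      the second stage pairs the first factor at \<open>(s, t\<^sub>0)\<close> with the second factor at \<open>(s\<^sub>0, t\<^sub>0)\<close>.\<close>
    have cross: "integrable (R1 \<theta> \<Otimes>\<^sub>M R2 \<theta>') H"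
      if "\<theta> \<in> \<Theta>\<^sub>1 \<times> \<Theta>\<^sub>2" "\<theta>' \<in> \<Theta>\<^sub>1 \<times> \<Theta>\<^sub>2" for \<theta> \<theta>'
    proof -
      have "H \<in> L1_model (C\<^sub>1 \<Otimes>\<^sub>M C\<^sub>2) {R1 \<theta> \<Otimes>\<^sub>M R2 \<theta> | \<theta>. \<theta> \<in> \<Theta>\<^sub>1 \<times> \<Theta>\<^sub>2}"
        using H own by (auto simp: L1_model_def)
      then have "H \<in> L1_model (C\<^sub>1 \<Otimes>\<^sub>M C\<^sub>2) {R1 \<theta> \<Otimes>\<^sub>M R2 \<theta>' | \<theta> \<theta>'.
          \<theta> \<in> \<Theta>\<^sub>1 \<times> \<Theta>\<^sub>2 \<and> \<theta>' \<in> \<Theta>\<^sub>1 \<times> \<Theta>\<^sub>2}"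
        using iv unfolding R1_def R2_def by simp
      then show ?thesis
        using that unfolding L1_model_def by blast
    qed
    have anc: "R1 (s, t) = R1 (s, t')" if "s \<in> \<Theta>\<^sub>1" "t \<in> \<Theta>\<^sub>2" "t' \<in> \<Theta>\<^sub>2" for s t t'
      using ii[OF that(1)] that unfolding ancillary_for_def R1_def by blast
    have own_section: "AE y in R2 (s, t\<^sub>0). (\<integral>x. H (x, y) \<partial>R1 (s, t\<^sub>0)) = 0" if s: "s \<in> \<Theta>\<^sub>1" for s
      unfolding R2_def
    proof (rule section_integral_vanishes[OF slice2[OF s] sub2])
      show "complete_for C\<^sub>2 {P (s, t) | t. t \<in> \<Theta>\<^sub>2}"
        using ii[OF s] by blast
      show "prob_space (R1 (s, t\<^sub>0))"
        using prob s st by blast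
      show "P (s, t\<^sub>0) \<in> {P (s, t) | t. t \<in> \<Theta>\<^sub>2}"
        using st by blast
      fix R assume "R \<in> {P (s, t) | t. t \<in> \<Theta>\<^sub>2}"
      then obtain t where t: "R = P (s, t)" "t \<in> \<Theta>\<^sub>2"
        by blast
      show "integrable (R1 (s, t\<^sub>0) \<Otimes>\<^sub>M restr_to_subalg R C\<^sub>2) H"
        "(\<integral>z. H z \<partial>(R1 (s, t\<^sub>0) \<Otimes>\<^sub>M restr_to_subalg R C\<^sub>2)) = 0"
        using own[of "(s, t)"] anc[OF s t(2) st(3)] s t by (simp_all add: R2_def)
    qed
    \<comment> \<open>Homogeneity moves the statement from the null sets of \<open>R2 (s, t\<^sub>0)\<close> to those of a law that
      does not vary with \<open>s\<close>.\<close>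
    have other_section: "AE y in R2 (s\<^sub>0, t\<^sub>0). (\<integral>x. H (x, y) \<partial>R1 (s, t\<^sub>0)) = 0" if s: "s \<in> \<Theta>\<^sub>1" for s
    proof (rule absolutely_continuous_AE[OF _ _ own_section[OF s]])
      show "sets (R2 (s\<^sub>0, t\<^sub>0)) = sets (R2 (s, t\<^sub>0))"
        using s st sub by (simp add: R2_def sets_restr_to_subalg)
      show "absolutely_continuous (R2 (s, t\<^sub>0)) (R2 (s\<^sub>0, t\<^sub>0))"
        using iii[OF st(3)] s st(2) unfolding homogeneous_def R2_def by blast
    qed
    have "AE z in restr_to_subalg Q C\<^sub>1 \<Otimes>\<^sub>M R2 (s\<^sub>0, t\<^sub>0). H z = 0"
    proof (rule product_vanishes_if_sections_vanish[OF slice1[OF st(3)] sub1 i[OF st(3)]])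
      show "prob_space (R2 (s\<^sub>0, t\<^sub>0))"
        using prob st by blast
      show "Q \<in> {P (s, t\<^sub>0) | s. s \<in> \<Theta>\<^sub>1}"
        using st by blast
      fix R assume "R \<in> {P (s, t\<^sub>0) | s. s \<in> \<Theta>\<^sub>1}"
      then obtain s where s: "R = P (s, t\<^sub>0)" "s \<in> \<Theta>\<^sub>1"
        by blast
      show "integrable (restr_to_subalg R C\<^sub>1 \<Otimes>\<^sub>M R2 (s\<^sub>0, t\<^sub>0)) H"
        using cross s st by (simp add: R1_def)
      show "AE y in R2 (s\<^sub>0, t\<^sub>0). (\<integral>x. H (x, y) \<partial>restr_to_subalg R C\<^sub>1) = 0"
        using other_section[OF s(2)] s(1) by (simp add: R1_def)
    qed
    then have ae: "AE z in distr Q (C\<^sub>1 \<Otimes>\<^sub>M C\<^sub>2) (\<lambda>x. (x, x)). H z = 0"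
      using diag(2)[of "(s\<^sub>0, t\<^sub>0)"] st(2,3) by (simp only: st(1) R1_def mem_Times_iff fst_conv snd_conv)
    have "(\<lambda>x. (x, x)) \<in> measurable Q (C\<^sub>1 \<Otimes>\<^sub>M C\<^sub>2)"
      using diag(1)[of "(s\<^sub>0, t\<^sub>0)"] st by simp
    from AE_distrD[OF this ae] AE_space show "AE x in Q. h x = 0"
    proof eventually_elim
      case (elim x)
      then show ?case
        using hH'[of x "(s\<^sub>0, t\<^sub>0)"] st by simp
    qed
  qed
qed

end
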